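(* Let $(\Omega,\mathcal{F})$ be a measurable space, $\mathcal{P}$ a nonempty set of probability measures on $(\Omega,\mathcal{F})$ and $c(A)=\sup_{P\in\mathcal{P}}P(A)$. Any convex set $\mathcal{A}\subset L^\infty_c$ which is $\sigma(L^\infty_c,ca_c)$-closed is $\mathcal{P}$-sensitive.
   Context: $\mathcal{M}_1$ is the set of all probability measures on $(\Omega,\mathcal{F})$. A statement holds $\mathcal{P}$-q.s. if it holds $P$-almost surely for every $P\in\mathcal{P}$. $ca$ is the space of all $\sigma$-additive $\mu:\mathcal{F}\to\mathbb{R}$ (finite signed measures), and $ca_c=\{\mu\in ca\mid c(A)=0\Rightarrow\mu(A)=0 \text{ for all } A\in\mathcal{F}\}$. $L^\infty_c$ is the space of bounded $\mathcal{F}$-measurable functions $\Omega\to\mathbb{R}$ modulo $\mathcal{P}$-q.s. equality. The topology $\sigma(L^\infty_c,ca_c)$ is the weak topology on $L^\infty_c$ induced by the functionals $X\mapsto\int X\,d\mu$, $\mu\in ca_c$. For $\mathcal{Q}\subset\mathcal{M}_1$, $\mathcal{Q}\ll\mathcal{P}$ means: for all $A\in\mathcal{F}$, $c(A)=0$ implies $Q(A)=0$ for all $Q\in\mathcal{Q}$. For $Q\in\mathcal{M}_1$ with $\{Q\}\ll\mathcal{P}$, $j_Q:L^\infty_c\to L^\infty_Q:=L^\infty(\Omega,\mathcal{F},Q)$ maps $X$ to the $Q$-a.s. equivalence class of any representative of $X$. A set $\mathcal{A}\subset L^\infty_c$ is $\mathcal{P}$-sensitive if there is $\mathcal{Q}\subset\mathcal{M}_1$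 with $\mathcal{Q}\ll\mathcal{P}$ such that $\mathcal{A}=\bigcap_{Q\in\mathcal{Q}}j_Q^{-1}(j_Q(\mathcal{A}))$, i.e. $j_Q(X)\in j_Q(\mathcal{A})$ for all $Q\in\mathcal{Q}$ implies $X\in\mathcal{A}$. *)

theory Defs
  imports "HOL-Probability.Probability"
begin

text \<open>The measurable space is given by \<open>space M\<close> and \<open>sets M\<close>; the measure carried by \<open>M\<close>
  itself plays no role.\<close>

definition prob_measures :: "'a measure \<Rightarrow> 'a measure set" where
  "prob_measures M = {P. prob_space P \<and> sets P = sets M}"

definition capacity :: "'a measure set \<Rightarrow> 'a set \<Rightarrow> real" where
  "capacity \<P> A = (SUP P\<in>\<P>. measure P A)"

definition quasi_surely :: "'a measure set \<Rightarrow> ('a \<Rightarrow> bool) \<Rightarrow> bool" where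
  "quasi_surely \<P> \<phi> \<longleftrightarrow> (\<forall>P\<in>\<P>. AE \<omega> in P. \<phi> \<omega>)"

definition dominated :: "'a measure \<Rightarrow> 'a measure set \<Rightarrow> 'a measure set \<Rightarrow> bool" where
  "dominated M \<Q> \<P> \<longleftrightarrow> (\<forall>A\<in>sets M. capacity \<P> A = 0 \<longrightarrow> (\<forall>Q\<in>\<Q>. measure Q A = 0))"


subsection \<open>Signed measures\<close>

text \<open>A set function on \<open>sets M\<close> is represented by its extension by \<open>0\<close>, as for \<^const>\<open>measure\<close>.
  Countable additivity already forces the value \<open>0\<close> on the empty set.\<close>

definition ca :: "'a measure \<Rightarrow> ('a set \<Rightarrow> real) set" where
  "ca M = {\<mu>. (\<forall>A. A \<notin> sets M \<longrightarrow> \<mu> A = 0) \<and>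
     (\<forall>A :: nat \<Rightarrow> 'a set. range A \<subseteq> sets M \<longrightarrow> disjoint_family A \<longrightarrow>
        (\<lambda>i. \<mu> (A i)) sums \<mu> (\<Union>i. A i))}"

definition ca_c :: "'a measure \<Rightarrow> 'a measure set \<Rightarrow> ('a set \<Rightarrow> real) set" where
  "ca_c M \<P> = {\<mu>\<in>ca M. \<forall>A\<in>sets M. capacity \<P> A = 0 \<longrightarrow> \<mu> A = 0}"

text \<open>The upper variation of \<open>\<mu>\<close>, that is the positive part of its Jordan decomposition; the
  negative part is the upper variation of \<open>- \<mu>\<close>. For \<open>\<mu> \<in> ca M\<close> both are finite measures.
  The truncation of negative values by \<open>ennreal\<close> does not affect the supremum, because \<open>B = {}\<close>
  already contributes \<open>0\<close>.\<close>

definition upper_variation :: "'a measure \<Rightarrow> ('a set \<Rightarrow> real) \<Rightarrow> 'a measure" where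
  "upper_variation M \<mu> =
     measure_of (space M) (sets M) (\<lambda>A. SUP B\<in>{B\<in>sets M. B \<subseteq> A}. ennreal (\<mu> B))"

definition signed_integral :: "'a measure \<Rightarrow> ('a set \<Rightarrow> real) \<Rightarrow> ('a \<Rightarrow> real) \<Rightarrow> real" where
  "signed_integral M \<mu> f =
     (\<integral>\<omega>. f \<omega> \<partial>upper_variation M \<mu>) - (\<integral>\<omega>. f \<omega> \<partial>upper_variation M (\<lambda>A. - \<mu> A))"


subsection \<open>The space of bounded functions modulo quasi-sure equality\<close>

definition bounded_measurable :: "'a measure \<Rightarrow> ('a \<Rightarrow> real) set" where
  "bounded_measurable M = {f\<in>borel_measurable M. \<exists>b. \<forall>\<omega>\<in>space M. \<bar>f \<omega>\<bar> \<le> b}"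

definition qs_rel :: "'a measure \<Rightarrow> 'a measure set \<Rightarrow> (('a \<Rightarrow> real) \<times> ('a \<Rightarrow> real)) set" where
  "qs_rel M \<P> = {(f, g). f \<in> bounded_measurable M \<and> g \<in> bounded_measurable M \<and>
     quasi_surely \<P> (\<lambda>\<omega>. f \<omega> = g \<omega>)}"

definition Linf_c :: "'a measure \<Rightarrow> 'a measure set \<Rightarrow> ('a \<Rightarrow> real) set set" where
  "Linf_c M \<P> = bounded_measurable M // qs_rel M \<P>"

text \<open>Operations on classes are induced by representatives; each union below is a single class,
  since the operation does not depend on the chosen representatives.\<close>

definition Linf_add ::
    "'a measure \<Rightarrow> 'a measure set \<Rightarrow> ('a \<Rightarrow> real) set \<Rightarrow> ('a \<Rightarrow> real) set \<Rightarrow> ('a \<Rightarrow> real) set" where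
  "Linf_add M \<P> X Y = (\<Union>f\<in>X. \<Union>g\<in>Y. qs_rel M \<P> `` {\<lambda>\<omega>. f \<omega> + g \<omega>})"

definition Linf_scale ::
    "'a measure \<Rightarrow> 'a measure set \<Rightarrow> real \<Rightarrow> ('a \<Rightarrow> real) set \<Rightarrow> ('a \<Rightarrow> real) set" where
  "Linf_scale M \<P> t X = (\<Union>f\<in>X. qs_rel M \<P> `` {\<lambda>\<omega>. t * f \<omega>})"

definition Linf_convex :: "'a measure \<Rightarrow> 'a measure set \<Rightarrow> ('a \<Rightarrow> real) set set \<Rightarrow> bool" where
  "Linf_convex M \<P> \<A> \<longleftrightarrow> (\<forall>X\<in>\<A>. \<forall>Y\<in>\<A>. \<forall>u\<ge>0. \<forall>v\<ge>0. u + v = 1 \<longrightarrow>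
     Linf_add M \<P> (Linf_scale M \<P> u X) (Linf_scale M \<P> v Y) \<in> \<A>)"

text \<open>For \<open>\<mu> \<in> ca_c M \<P>\<close> the integral is the same for all representatives of a class.\<close>

definition class_integral :: "'a measure \<Rightarrow> ('a set \<Rightarrow> real) \<Rightarrow> ('a \<Rightarrow> real) set \<Rightarrow> real" where
  "class_integral M \<mu> X = signed_integral M \<mu> (SOME f. f \<in> X)"

definition weak_topology :: "'a measure \<Rightarrow> 'a measure set \<Rightarrow> ('a \<Rightarrow> real) set topology" where
  "weak_topology M \<P> = topology_generated_by
     {{X \<in> Linf_c M \<P>. class_integral M \<mu> X \<in> V} | \<mu> V. \<mu> \<in> ca_c M \<P> \<and> open V}"


subsection \<open>Sensitivity\<close>

text \<open>\<open>L\<^sup>\<infinity>\<close> over a single measure: essentially bounded measurable functions modulo almost sure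
  equality. The map \<open>to_Linf Q\<close> is meaningful on \<open>Linf_c M \<P>\<close> when \<open>{Q}\<close> is dominated by \<open>\<P>\<close>.\<close>

definition ess_bounded :: "'a measure \<Rightarrow> ('a \<Rightarrow> real) set" where
  "ess_bounded Q = {f\<in>borel_measurable Q. \<exists>b. AE \<omega> in Q. \<bar>f \<omega>\<bar> \<le> b}"

definition as_rel :: "'a measure \<Rightarrow> (('a \<Rightarrow> real) \<times> ('a \<Rightarrow> real)) set" where
  "as_rel Q = {(f, g). f \<in> ess_bounded Q \<and> g \<in> ess_bounded Q \<and> (AE \<omega> in Q. f \<omega> = g \<omega>)}"

definition to_Linf :: "'a measure \<Rightarrow> ('a \<Rightarrow> real) set \<Rightarrow> ('a \<Rightarrow> real) set" where
  "to_Linf Q X = (\<Union>f\<in>X. as_rel Q `` {f})"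

text \<open>The intersection over \<open>Q \<in> \<Q>\<close> is taken inside \<open>Linf_c M \<P>\<close>, so that it is all of
  \<open>Linf_c M \<P>\<close> when \<open>\<Q>\<close> is empty.\<close>

definition sensitive :: "'a measure \<Rightarrow> 'a measure set \<Rightarrow> ('a \<Rightarrow> real) set set \<Rightarrow> bool" where
  "sensitive M \<P> \<A> \<longleftrightarrow> (\<exists>\<Q>. \<Q> \<subseteq> prob_measures M \<and> dominated M \<Q> \<P> \<and>
     \<A> = {X \<in> Linf_c M \<P>. \<forall>Q\<in>\<Q>. to_Linf Q X \<in> to_Linf Q ` \<A>})"

end

theory Submission
  imports Defs
begin

text \<open>An open neighbourhood of \<open>X\<close> constrains only finitely many
  \<open>\<mu>\<^sub>1, \<dots>, \<mu>\<^sub>n \<in> ca\<^sub>c\<close>, and the total variations of these are all absolutely continuous with respect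
  to a single probability measure \<open>Q\<close> dominated by \<open>\<P>\<close>. Hence a class having the same image as
  \<open>X\<close> under \<open>j\<^sub>Q\<close> lies in the same neighbourhood, and the set of all dominated probability measures
  witnesses the sensitivity of every closed set.\<close>

section \<open>Boundedness of countably additive set functions\<close>

lemma ca_empty:
  assumes "\<mu> \<in> ca M"
  shows "\<mu> {} = 0"
proof -
  have "(\<lambda>i::nat. \<mu> {}) sums \<mu> (\<Union>i::nat. {})"
    using assms unfolding ca_def by (auto simp: disjoint_family_on_def)
  then show ?thesis
    using summable_const_iff sums_summable by blast
qed

text \<open>The sequence \<open>A\<close>, \<open>B\<close>, \<open>{}\<close>, \<open>{}\<close>,
  ... turns countable into finite additivity; its tail contributes nothing by
  \<open>ca_empty\<close>.\<close>

lemma ca_Un: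
  assumes "\<mu> \<in> ca M" "A \<in> sets M" "B \<in> sets M" "A \<inter> B = {}"
  shows "\<mu> (A \<union> B) = \<mu> A + \<mu> B"
proof -
  have "range (binaryset A B) \<subseteq> sets M"
    using assms by (auto simp: range_binaryset_eq)
  moreover have "disjoint_family (binaryset A B)"
    using assms by (auto simp: disjoint_family_on_def binaryset_def)
  ultimately have "(\<lambda>i. \<mu> (binaryset A B i)) sums \<mu> (\<Union>i. binaryset A B i)"
    using assms(1) unfolding ca_def by blast
  then have "(\<lambda>i. \<mu> (binaryset A B i)) sums \<mu> (A \<union> B)"
    by (simp add: UN_binaryset_eq)
  then show ?thesis
    using binaryset_sums[of \<mu> A B] ca_empty[OF assms(1)] sums_unique2 by blast
qed

lemma ca_uminus: "\<mu> \<in> ca M \<Longrightarrow> (\<lambda>A. - \<mu> A) \<in> ca M"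
  unfolding ca_def by (auto intro: sums_minus)

text \<open>Cut \<open>A\<close> into two pieces on each of which |\<mu>| exceeds 1. At least one
  piece still has subsets of arbitrarily large \<mu>; that piece becomes \<open>A'\<close> and the
  other one is discarded.\<close>

lemma ca_unbounded_step:
  assumes \<mu>: "\<mu> \<in> ca M" and A: "A \<in> sets M"
    and unb: "\<not> bdd_above (\<mu> ` {B \<in> sets M. B \<subseteq> A})"
  shows "\<exists>A'. (A' \<in> sets M \<and> \<not> bdd_above (\<mu> ` {B \<in> sets M. B \<subseteq> A'})) \<and>
    A' \<subseteq> A \<and> 1 < \<bar>\<mu> (A - A')\<bar>"
proof -
  \<comment> \<open>The threshold makes both pieces large: it gives \<mu> B > 1, and also \<mu> (A -
    B) = \<mu> A - \<mu> B < -1.\<close>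
  obtain B where B: "B \<in> sets M" "B \<subseteq> A" "1 + \<bar>\<mu> A\<bar> < \<mu> B"
    using unb unfolding bdd_above_def by (auto simp: not_le)
  have "\<mu> (B \<union> (A - B)) = \<mu> B + \<mu> (A - B)"
    using A B by (intro ca_Un[OF \<mu>]) auto
  moreover have "B \<union> (A - B) = A" using B by auto
  ultimately have large: "1 < \<bar>\<mu> B\<bar>" "1 < \<bar>\<mu> (A - B)\<bar>" using B by auto
  \<comment> \<open>Upper bounds for the subsets of the two pieces would add up to an upper bound
    for all measurable subsets of \<open>A\<close>.\<close>
  have "\<not> bdd_above (\<mu> ` {C \<in> sets M. C \<subseteq> B}) \<or> \<not> bdd_above (\<mu> ` {C \<in> sets M. C \<subseteq> A - B})"
  proof (rule ccontr)
    assume "\<not> ?thesis"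
    then obtain b d where b: "\<And>C. C \<in> sets M \<Longrightarrow> C \<subseteq> B \<Longrightarrow> \<mu> C \<le> b"
      and d: "\<And>C. C \<in> sets M \<Longrightarrow> C \<subseteq> A - B \<Longrightarrow> \<mu> C \<le> d"
      unfolding bdd_above_def by blast
    have "\<mu> C \<le> b + d" if C: "C \<in> sets M" "C \<subseteq> A" for C
    proof -
      have "\<mu> ((C \<inter> B) \<union> (C - B)) = \<mu> (C \<inter> B) + \<mu> (C - B)"
        using B C by (intro ca_Un[OF \<mu>]) auto
      moreover have "(C \<inter> B) \<union> (C - B) = C" by auto
      moreover have "\<mu> (C \<inter> B) \<le> b" using B C by (intro b) auto
      moreover have "\<mu> (C - B) \<le> d" using B C by (intro d) auto
      ultimately show ?thesis by simp
    qed
    then have "bdd_above (\<mu> ` {B \<in> sets M. B \<subseteq> A})" by (auto simp: bdd_above_def)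
    with unb show False by blast
  qed
  moreover have "A - (A - B) = B" using B by auto
  ultimately show ?thesis
    using A B large by (metis Diff_subset sets.Diff)
qed

text \<open>Otherwise iterating \<open>ca_unbounded_step\<close> from the whole space yields a
  decreasing sequence. Its successive differences are disjoint and have |\<mu>| > 1, whereas the
  values of \<mu> on a disjoint sequence form a convergent series and tend to 0.\<close>

lemma ca_bdd_above:
  assumes \<mu>: "\<mu> \<in> ca M"
  shows "bdd_above (\<mu> ` {B \<in> sets M. B \<subseteq> space M})"
proof (rule ccontr)
  assume unb: "\<not> ?thesis"
  let ?U = "\<lambda>A. A \<in> sets M \<and> \<not> bdd_above (\<mu> ` {B \<in> sets M. B \<subseteq> A})"
  have "\<exists>E. \<forall>n. ?U (E n) \<and> E (Suc n) \<subseteq> E n \<and> 1 < \<bar>\<mu> (E n - E (Suc n))\<bar>"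
  proof (rule dependent_nat_choice)
    show "\<exists>A. ?U A" using unb by (intro exI[of _ "space M"]) simp
    show "\<exists>B. ?U B \<and> B \<subseteq> A \<and> 1 < \<bar>\<mu> (A - B)\<bar>" if "?U A" for A n
      using that by (intro ca_unbounded_step[OF \<mu>]) auto
  qed
  then obtain E where "\<forall>n. ?U (E n) \<and> E (Suc n) \<subseteq> E n \<and> 1 < \<bar>\<mu> (E n - E (Suc n))\<bar>" ..
  then have E: "\<And>n. E n \<in> sets M" "\<And>n. E (Suc n) \<subseteq> E n"
      "\<And>n. 1 < \<bar>\<mu> (E n - E (Suc n))\<bar>"
    by simp_all
  let ?D = "\<lambda>n. E n - E (Suc n)"
  have "decseq E" using E by (simp add: decseq_Suc_iff)
  then have "?D m \<inter> ?D n = {}" if "m < n" for m n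
    using that decseqD[of E "Suc m" n] by auto
  then have "disjoint_family ?D"
    unfolding disjoint_family_on_def by (metis Int_commute linorder_neqE_nat)
  moreover have "range ?D \<subseteq> sets M" using E by auto
  ultimately have "(\<lambda>n. \<mu> (?D n)) sums \<mu> (\<Union>n. ?D n)"
    using \<mu> unfolding ca_def by blast
  then have "(\<lambda>n. \<mu> (?D n)) \<longlonglongrightarrow> 0"
    by (intro summable_LIMSEQ_zero) (rule sums_summable)
  then have "eventually (\<lambda>n. \<bar>\<mu> (?D n)\<bar> < 1) sequentially"
    by (auto simp: tendsto_iff dist_real_def)
  then obtain n where "\<bar>\<mu> (?D n)\<bar> < 1"
    unfolding eventually_sequentially by blast
  with E(3)[of n] show False by linarith
qed

section \<open>Upper variations\<close>

lemma sets_upper_variation [simp]: "sets (upper_variation M \<mu>) = sets M"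
  and space_upper_variation [simp]: "space (upper_variation M \<mu>) = space M"
  by (auto simp: upper_variation_def sets.space_closed sets.sigma_sets_eq)

text \<open>The junk value of \<^const>\<open>measure_of\<close> is the zero measure, so this bound
  needs no proof that the upper variation is \<open>\<sigma>\<close>-additive.\<close>

lemma emeasure_upper_variation_le:
  "emeasure (upper_variation M \<mu>) A \<le> (SUP B\<in>{B\<in>sets M. B \<subseteq> A}. ennreal (\<mu> B))"
  unfolding upper_variation_def by (subst emeasure_measure_of_conv) auto

text \<open>The total mass is at most the supremum of \<mu> over all measurable sets, which is
  finite by \<open>ca_bdd_above\<close>.\<close>

lemma finite_measure_upper_variation:
  assumes "\<mu> \<in> ca M"
  shows "finite_measure (upper_variation M \<mu>)"
proof
  obtain b where "\<And>B. B \<in> sets M \<Longrightarrow> B \<subseteq> space M \<Longrightarrow> \<mu> B \<le> b"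
    using ca_bdd_above[OF assms] by (auto simp: bdd_above_def)
  then have "(SUP B\<in>{B\<in>sets M. B \<subseteq> space M}. ennreal (\<mu> B)) \<le> ennreal b"
    by (intro SUP_least ennreal_leI) auto
  also have "\<dots> < \<top>" by simp
  finally show "emeasure (upper_variation M \<mu>) (space (upper_variation M \<mu>)) \<noteq> \<infinity>"
    using emeasure_upper_variation_le[of M \<mu> "space M"] by (auto simp: top_unique)
qed

section \<open>Null sets of the capacity and dominated probability measures\<close>

text \<open>The supremum is taken in the reals: the common bound 1 makes it an upper bound of the
  family, and nonemptiness of \<P> gives it the value 0 when all members vanish.\<close>

lemma capacity_eq_0_iff:
  assumes "\<P> \<noteq> {}" "\<P> \<subseteq> prob_measures M"
  shows "capacity \<P> A = 0 \<longleftrightarrow> (\<forall>P\<in>\<P>. measure P A = 0)"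
proof
  assume *: "capacity \<P> A = 0"
  have "bdd_above ((\<lambda>P. measure P A) ` \<P>)"
    using assms by (intro bdd_aboveI[of _ 1]) (auto simp: prob_measures_def prob_space.prob_le_1)
  then have "measure P A \<le> 0" if "P \<in> \<P>" for P
    using cSUP_upper[OF that] * unfolding capacity_def by metis
  then show "\<forall>P\<in>\<P>. measure P A = 0"
    by (meson antisym measure_nonneg)
next
  assume "\<forall>P\<in>\<P>. measure P A = 0"
  then show "capacity \<P> A = 0"
    using assms(1) by (simp add: capacity_def)
qed

text \<open>Measurable subsets of a set of capacity 0 have capacity 0 by monotonicity of each member
  of \<P>. So \<mu> vanishes on all of them, and the supremum defining the upper variation is
  0.\<close>

lemma emeasure_upper_variation_eq_0:
  assumes P: "\<P> \<noteq> {}" "\<P> \<subseteq> prob_measures M" and \<mu>: "\<mu> \<in> ca_c M \<P>"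
    and A: "A \<in> sets M" "capacity \<P> A = 0"
  shows "emeasure (upper_variation M \<mu>) A = 0"
proof -
  have "\<mu> B = 0" if B: "B \<in> sets M" "B \<subseteq> A" for B
  proof -
    have "measure P B = 0" if "P \<in> \<P>" for P
    proof -
      have fin: "finite_measure P" and s: "sets P = sets M"
        using P(2) that by (auto simp: prob_measures_def prob_space.finite_measure)
      have "measure P B \<le> measure P A"
        using A B s by (intro finite_measure.finite_measure_mono[OF fin]) auto
      also have "\<dots> = 0" using A(2) that capacity_eq_0_iff[OF P] by blast
      finally show ?thesis using measure_nonneg[of P B] by linarith
    qed
    then show ?thesis
      using \<mu> B(1) capacity_eq_0_iff[OF P] unfolding ca_c_def by blast
  qed
  then have "(SUP B\<in>{B\<in>sets M. B \<subseteq> A}. ennreal (\<mu> B)) \<le> 0"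
    by (intro SUP_least) auto
  then show ?thesis
    using emeasure_upper_variation_le[of M \<mu> A] by auto
qed

text \<open>Domination is a condition on each member separately, so this set is itself dominated by
  \<P> and is the largest family that \<open>sensitive\<close> admits as a witness.\<close>

definition dominated_probs :: "'a measure \<Rightarrow> 'a measure set \<Rightarrow> 'a measure set" where
  "dominated_probs M \<P> = {Q \<in> prob_measures M. dominated M {Q} \<P>}"

lemma dominated_probsD:
  assumes "Q \<in> dominated_probs M \<P>"
  shows "prob_space Q" "sets Q = sets M" "space Q = space M"
    "\<And>A. A \<in> sets M \<Longrightarrow> capacity \<P> A = 0 \<Longrightarrow> emeasure Q A = 0"
proof -
  show *: "prob_space Q" "sets Q = sets M"
    using assms by (auto simp: dominated_probs_def prob_measures_def)
  then show "space Q = space M" using sets_eq_imp_space_eq by blast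
  show "emeasure Q A = 0" if "A \<in> sets M" "capacity \<P> A = 0" for A
    using assms that *
    by (simp add: dominated_probs_def dominated_def
        finite_measure.emeasure_eq_measure[OF prob_space.finite_measure])
qed

lemma dominated_probsI:
  assumes "prob_space Q" "sets Q = sets M"
    "\<And>A. A \<in> sets M \<Longrightarrow> capacity \<P> A = 0 \<Longrightarrow> emeasure Q A = 0"
  shows "Q \<in> dominated_probs M \<P>"
  using assms by (auto simp: dominated_probs_def prob_measures_def dominated_def measure_def)

lemma dominated_probs_superset:
  assumes "\<P> \<noteq> {}" "\<P> \<subseteq> prob_measures M"
  shows "\<P> \<subseteq> dominated_probs M \<P>"
  using assms capacity_eq_0_iff[OF assms] by (auto simp: dominated_probs_def dominated_def)

text \<open>Normalising \<open>N\<close> preserves its null sets. Note the argument order: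
  \<open>absolutely_continuous Q N\<close> says that every null set of \<open>Q\<close> is a null
  set of \<open>N\<close>.\<close>

lemma obtain_dominated_prob:
  assumes P: "\<P> \<noteq> {}" "\<P> \<subseteq> prob_measures M"
    and N: "finite_measure N" "sets N = sets M"
    and N0: "\<And>A. A \<in> sets M \<Longrightarrow> capacity \<P> A = 0 \<Longrightarrow> emeasure N A = 0"
  obtains Q where "Q \<in> dominated_probs M \<P>" "absolutely_continuous Q N"
proof (cases "emeasure N (space N) = 0")
  case True
  \<comment> \<open>The zero measure cannot be normalised, but it is absolutely continuous with
    respect to any member of \<P>.\<close>
  obtain P where "P \<in> \<P>" using P by auto
  then have "P \<in> dominated_probs M \<P>" using dominated_probs_superset[OF P] by auto
  moreover have "absolutely_continuous P N"
    using True N(2) dominated_probsD(2)[OF calculation]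
    by (metis absolutely_continuous_def emeasure_eq_0 null_setsD2 null_setsI null_sets_def
        sets.sets_into_space sets.top subsetI)
  ultimately show ?thesis by (rule that)
next
  case False
  let ?c = "emeasure N (space N)"
  have fin: "?c \<noteq> \<infinity>" using finite_measure.emeasure_finite[OF N(1)] by simp
  let ?Q = "scale_measure (inverse ?c) N"
  have "?Q \<in> dominated_probs M \<P>"
  proof (rule dominated_probsI)
    have "inverse ?c * ?c = 1"
      using False fin ennreal_divide_self[of ?c] by (simp add: divide_ennreal_def mult.commute top.not_eq_extremum)
    then show "prob_space ?Q"
      by (intro prob_spaceI) (simp add: space_scale_measure)
  qed (use N N0 in auto)
  \<comment> \<open>Finiteness of the total mass makes the scaling factor nonzero, so no new null
    sets arise.\<close>
  moreover have "absolutely_continuous ?Q N"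
    using fin by (auto simp: absolutely_continuous_def null_sets_def)
  ultimately show ?thesis by (rule that)
qed

text \<open>The null sets of the sum of the two measures are exactly their common null sets;
  normalising the sum gives \<open>Q\<close>.\<close>

lemma dominated_probs_common:
  assumes Q: "Q\<^sub>1 \<in> dominated_probs M \<P>" "Q\<^sub>2 \<in> dominated_probs M \<P>"
    and P: "\<P> \<noteq> {}" "\<P> \<subseteq> prob_measures M"
  obtains Q where "Q \<in> dominated_probs M \<P>" "absolutely_continuous Q Q\<^sub>1"
    "absolutely_continuous Q Q\<^sub>2"
proof -
  let ?s = "\<lambda>A. emeasure Q\<^sub>1 A + emeasure Q\<^sub>2 A"
  define N where "N = measure_of (space M) (sets M) ?s"
  note Q1 = dominated_probsD[OF Q(1)] and Q2 = dominated_probsD[OF Q(2)]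
  have sN: "sets N = sets M"
    by (simp add: N_def sets.space_closed sets.sigma_sets_eq)
  then have spN: "space N = space M" using sets_eq_imp_space_eq by blast
  have eN: "emeasure N A = ?s A" if "A \<in> sets M" for A
  proof (rule emeasure_measure_of[OF N_def])
    show "countably_additive (sets N) ?s"
    proof (rule countably_additiveI)
      fix A :: "nat \<Rightarrow> 'a set" assume A: "range A \<subseteq> sets N" "disjoint_family A"
      show "(\<Sum>i. ?s (A i)) = ?s (\<Union>i. A i)"
        using A sN Q1(2) Q2(2) by (simp add: suminf_add[symmetric] suminf_emeasure)
    qed
  qed (use that sN sets.space_closed in \<open>auto simp: positive_def\<close>)
  have "finite_measure N"
    using Q1 Q2 sN spN eN[of "space M"]
    by (intro finite_measureI) (auto dest!: prob_space.emeasure_space_1)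
  moreover have "emeasure N A = 0" if "A \<in> sets M" "capacity \<P> A = 0" for A
    using that Q1(4) Q2(4) eN by simp
  ultimately obtain Q where "Q \<in> dominated_probs M \<P>" "absolutely_continuous Q N"
    using obtain_dominated_prob[OF P _ sN] by metis
  moreover have "absolutely_continuous N Q\<^sub>1" "absolutely_continuous N Q\<^sub>2"
    using Q1(2) Q2(2) sN eN by (auto simp: absolutely_continuous_def null_sets_def)
  ultimately show ?thesis
    by (intro that[of Q]) (auto simp: absolutely_continuous_def)
qed

text \<open>The signed integral involves only the upper variations of \<mu> and of its negative.
  Each is controlled by a dominated probability measure after normalisation, and these two are then
  merged.\<close>

lemma obtain_prob_signed_measure:
  assumes P: "\<P> \<noteq> {}" "\<P> \<subseteq> prob_measures M" and \<mu>: "\<mu> \<in> ca_c M \<P>"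
  obtains Q where "Q \<in> dominated_probs M \<P>" "absolutely_continuous Q (upper_variation M \<mu>)"
    "absolutely_continuous Q (upper_variation M (\<lambda>A. - \<mu> A))"
proof -
  have \<nu>: "(\<lambda>A. - \<mu> A) \<in> ca_c M \<P>"
    using \<mu> ca_uminus by (auto simp: ca_c_def)
  have *: "\<exists>Q\<in>dominated_probs M \<P>. absolutely_continuous Q (upper_variation M \<nu>)"
    if \<nu>: "\<nu> \<in> ca_c M \<P>" for \<nu>
  proof -
    have "finite_measure (upper_variation M \<nu>)"
      using \<nu> by (intro finite_measure_upper_variation) (simp add: ca_c_def)
    then show ?thesis
      using obtain_dominated_prob[OF P _ sets_upper_variation]
        emeasure_upper_variation_eq_0[OF P \<nu>] by metis
  qed
  obtain Q\<^sub>1 Q\<^sub>2 where "Q\<^sub>1 \<in> dominated_probs M \<P>" "Q\<^sub>2 \<in> dominated_probs M \<P>"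
    and ac: "absolutely_continuous Q\<^sub>1 (upper_variation M \<mu>)"
      "absolutely_continuous Q\<^sub>2 (upper_variation M (\<lambda>A. - \<mu> A))"
    using *[OF \<mu>] *[OF \<nu>] by blast
  then obtain Q where "Q \<in> dominated_probs M \<P>" "absolutely_continuous Q Q\<^sub>1"
    "absolutely_continuous Q Q\<^sub>2"
    using dominated_probs_common[OF _ _ P] by metis
  then show ?thesis
    using that ac unfolding absolutely_continuous_def by blast
qed

text \<open>The set where \<open>f\<close> and \<open>g\<close> differ has capacity 0, hence is null
  for \<open>Q\<close>. This is why \<open>to_Linf Q\<close> does not depend on
  representatives.\<close>

lemma AE_dominated_prob:
  assumes P: "\<P> \<noteq> {}" "\<P> \<subseteq> prob_measures M" and Q: "Q \<in> dominated_probs M \<P>"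
    and meas: "f \<in> borel_measurable M" "g \<in> borel_measurable M"
    and eq: "quasi_surely \<P> (\<lambda>\<omega>. f \<omega> = (g \<omega> :: real))"
  shows "AE \<omega> in Q. f \<omega> = g \<omega>"
proof -
  let ?A = "{\<omega> \<in> space M. f \<omega> \<noteq> g \<omega>}"
  have A: "?A \<in> sets M" using meas by (rule borel_measurable_neq)
  have "measure P ?A = 0" if "P \<in> \<P>" for P
  proof -
    have "sets P = sets M" using P(2) that by (auto simp: prob_measures_def)
    then have "space P = space M" by (rule sets_eq_imp_space_eq)
    moreover have "AE \<omega> in P. f \<omega> = g \<omega>"
      using eq that by (auto simp: quasi_surely_def)
    ultimately have "emeasure P ?A = 0"
      using A \<open>sets P = sets M\<close> by (subst (asm) AE_iff_measurable[of ?A]) auto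
    then show ?thesis by (simp add: measure_def)
  qed
  then have "emeasure Q ?A = 0"
    using A capacity_eq_0_iff[OF P] dominated_probsD(4)[OF Q] by blast
  then show ?thesis
    using A dominated_probsD[OF Q] by (intro AE_I[of _ _ ?A]) auto
qed

section \<open>Quasi-sure classes and their images under \<open>to_Linf\<close>\<close>

text \<open>A class contains the function generating it, so the choice made in
  \<open>class_integral\<close> does pick a representative. Two members are compared through the
  generating function.\<close>

lemma Linf_c_mem:
  assumes "X \<in> Linf_c M \<P>"
  shows "(SOME f. f \<in> X) \<in> X"
    and "f \<in> X \<Longrightarrow> f \<in> bounded_measurable M"
    and "f \<in> X \<Longrightarrow> g \<in> X \<Longrightarrow> quasi_surely \<P> (\<lambda>\<omega>. f \<omega> = g \<omega>)"
proof -
  obtain h where h: "h \<in> bounded_measurable M" "X = qs_rel M \<P> `` {h}"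
    using assms unfolding Linf_c_def quotient_def by blast
  have "h \<in> X" using h by (auto simp: qs_rel_def quasi_surely_def)
  then show "(SOME f. f \<in> X) \<in> X" using some_in_eq by blast
  show "f \<in> bounded_measurable M" if "f \<in> X" using that h by (auto simp: qs_rel_def)
  show "quasi_surely \<P> (\<lambda>\<omega>. f \<omega> = g \<omega>)" if "f \<in> X" "g \<in> X"
    unfolding quasi_surely_def
  proof
    fix P assume "P \<in> \<P>"
    then have "AE \<omega> in P. h \<omega> = f \<omega>" "AE \<omega> in P. h \<omega> = g \<omega>"
      using that h by (auto simp: qs_rel_def quasi_surely_def)
    then show "AE \<omega> in P. f \<omega> = g \<omega>" by eventually_elim simp
  qed
qed

lemma bounded_measurable_imp_ess_bounded:
  assumes "f \<in> bounded_measurable M" and Q: "sets Q = sets M"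
  shows "f \<in> ess_bounded Q"
proof -
  obtain b where "f \<in> borel_measurable M" "\<forall>\<omega>\<in>space M. \<bar>f \<omega>\<bar> \<le> b"
    using assms(1) by (auto simp: bounded_measurable_def)
  then have "f \<in> borel_measurable Q" "\<forall>\<omega>\<in>space Q. \<bar>f \<omega>\<bar> \<le> b"
    using measurable_cong_sets[OF Q refl, of borel] sets_eq_imp_space_eq[OF Q] by auto
  moreover from this(2) have "AE \<omega> in Q. \<bar>f \<omega>\<bar> \<le> b" by (intro AE_I2) simp
  ultimately show ?thesis unfolding ess_bounded_def by blast
qed

text \<open>By reflexivity \<open>f\<close> lies in the image of \<open>X\<close>, hence in that of
  \<open>Y\<close>. So \<open>f\<close> agrees \<open>Q\<close>-almost surely with some
  \<open>h\<close> in \<open>Y\<close>, and \<open>h\<close> agrees quasi-surely with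
  \<open>g\<close>.\<close>

lemma to_Linf_eqD:
  assumes P: "\<P> \<noteq> {}" "\<P> \<subseteq> prob_measures M" and Q: "Q \<in> dominated_probs M \<P>"
    and X: "X \<in> Linf_c M \<P>" and Y: "Y \<in> Linf_c M \<P>"
    and eq: "to_Linf Q X = to_Linf Q Y" and f: "f \<in> X" and g: "g \<in> Y"
  shows "AE \<omega> in Q. f \<omega> = g \<omega>"
proof -
  have "f \<in> ess_bounded Q"
    by (rule bounded_measurable_imp_ess_bounded
        [OF Linf_c_mem(2)[OF X f] dominated_probsD(2)[OF Q]])
  then have "(f, f) \<in> as_rel Q" by (simp add: as_rel_def)
  then have "f \<in> to_Linf Q X"
    using f by (auto simp: to_Linf_def)
  then obtain h where h: "h \<in> Y" "(h, f) \<in> as_rel Q"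
    unfolding eq by (auto simp: to_Linf_def)
  have "AE \<omega> in Q. h \<omega> = g \<omega>"
    using Linf_c_mem(2)[OF Y] Linf_c_mem(3)[OF Y h(1) g] h(1) g
    by (intro AE_dominated_prob[OF P Q]) (auto simp: bounded_measurable_def)
  moreover have "AE \<omega> in Q. h \<omega> = f \<omega>" using h(2) by (simp add: as_rel_def)
  ultimately show ?thesis by eventually_elim simp
qed

lemma integral_cong_absolutely_continuous:
  assumes "absolutely_continuous Q N" "sets N = sets Q" "AE \<omega> in Q. f \<omega> = (g \<omega> :: real)"
    and "f \<in> borel_measurable Q" "g \<in> borel_measurable Q"
  shows "(\<integral>\<omega>. f \<omega> \<partial>N) = (\<integral>\<omega>. g \<omega> \<partial>N)"
  using assms absolutely_continuous_AE[of N Q "\<lambda>\<omega>. f \<omega> = g \<omega>"] measurable_cong_sets[of N Q borel borel]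
  by (intro integral_cong_AE) auto

text \<open>The chosen representatives agree \<open>Q\<close>-almost surely, hence almost everywhere
  for both variations, so neither integral distinguishes them.\<close>

lemma class_integral_cong:
  assumes P: "\<P> \<noteq> {}" "\<P> \<subseteq> prob_measures M" and Q: "Q \<in> dominated_probs M \<P>"
    and ac: "absolutely_continuous Q (upper_variation M \<mu>)"
      "absolutely_continuous Q (upper_variation M (\<lambda>A. - \<mu> A))"
    and X: "X \<in> Linf_c M \<P>" and Y: "Y \<in> Linf_c M \<P>"
    and eq: "to_Linf Q X = to_Linf Q Y"
  shows "class_integral M \<mu> X = class_integral M \<mu> Y"
proof -
  let ?f = "SOME f. f \<in> X" and ?g = "SOME g. g \<in> Y"
  have ae: "AE \<omega> in Q. ?f \<omega> = ?g \<omega>"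
    by (rule to_Linf_eqD[OF P Q X Y eq Linf_c_mem(1)[OF X] Linf_c_mem(1)[OF Y]])
  have "?f \<in> borel_measurable Q" "?g \<in> borel_measurable Q"
    using Linf_c_mem(1,2)[OF X] Linf_c_mem(1,2)[OF Y]
      measurable_cong_sets[OF dominated_probsD(2)[OF Q] refl, of borel]
    by (auto simp: bounded_measurable_def)
  then show ?thesis
    unfolding class_integral_def signed_integral_def
    using integral_cong_absolutely_continuous[OF ac(1) _ ae]
      integral_cong_absolutely_continuous[OF ac(2) _ ae] dominated_probsD(2)[OF Q]
    by simp
qed

text \<open>\<open>Q'\<close> has at least the null sets of \<open>Q\<close>, so
  \<open>Q\<close>-almost sure equality of representatives passes to \<open>Q'\<close>. This allows
  two measures to be replaced by a common dominating one.\<close>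

lemma to_Linf_eq_absolutely_continuous:
  assumes P: "\<P> \<noteq> {}" "\<P> \<subseteq> prob_measures M"
    and Q: "Q \<in> dominated_probs M \<P>" "Q' \<in> dominated_probs M \<P>"
    and ac: "absolutely_continuous Q Q'"
    and X: "X \<in> Linf_c M \<P>" and Y: "Y \<in> Linf_c M \<P>"
    and eq: "to_Linf Q X = to_Linf Q Y"
  shows "to_Linf Q' X = to_Linf Q' Y"
proof -
  have s: "sets Q' = sets Q" using Q dominated_probsD(2) by blast
  \<comment> \<open>Stated for arbitrary classes, so that exchanging their roles yields the reverse
    inclusion.\<close>
  have sub: "to_Linf Q' X \<subseteq> to_Linf Q' Y"
    if X: "X \<in> Linf_c M \<P>" and Y: "Y \<in> Linf_c M \<P>" and eq: "to_Linf Q X = to_Linf Q Y" for X Y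
  proof
    fix h assume "h \<in> to_Linf Q' X"
    then obtain f where f: "f \<in> X" "(f, h) \<in> as_rel Q'" by (auto simp: to_Linf_def)
    define g where "g = (SOME g. g \<in> Y)"
    have g: "g \<in> Y" unfolding g_def by (rule Linf_c_mem(1)[OF Y])
    have "g \<in> ess_bounded Q'"
      by (rule bounded_measurable_imp_ess_bounded
        [OF Linf_c_mem(2)[OF Y g] dominated_probsD(2)[OF Q(2)]])
    moreover have "AE \<omega> in Q'. f \<omega> = g \<omega>"
      by (rule absolutely_continuous_AE[OF s ac to_Linf_eqD[OF P Q(1) X Y eq f(1) g]])
    moreover have "AE \<omega> in Q'. f \<omega> = h \<omega>" "h \<in> ess_bounded Q'"
      using f(2) by (auto simp: as_rel_def)
    ultimately have "(g, h) \<in> as_rel Q'"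
      by (auto simp: as_rel_def elim: eventually_elim2)
    then show "h \<in> to_Linf Q' Y"
      using g by (auto simp: to_Linf_def)
  qed
  show ?thesis using sub[OF X Y eq] sub[OF Y X eq[symmetric]] by blast
qed

section \<open>Weakly open sets and sensitivity of closed sets\<close>

text \<open>Induction on the generation of the open set, with \<open>X\<close> fixed. A generator
  involves a single \<mu>, whose class integral is constant on a suitable fibre; a union uses the
  measure of a member containing \<open>X\<close>.\<close>

lemma weak_open_contains_fibre:
  assumes P: "\<P> \<noteq> {}" "\<P> \<subseteq> prob_measures M"
    and U: "openin (weak_topology M \<P>) U" and X: "X \<in> U" "X \<in> Linf_c M \<P>"
  shows "\<exists>Q\<in>dominated_probs M \<P>. \<forall>Y\<in>Linf_c M \<P>. to_Linf Q X = to_Linf Q Y \<longrightarrow> Y \<in> U"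
proof -
  have "generate_topology_on
    {{X \<in> Linf_c M \<P>. class_integral M \<mu> X \<in> V} | \<mu> V. \<mu> \<in> ca_c M \<P> \<and> open V} U"
    using U unfolding weak_topology_def by (simp add: openin_topology_generated_by_iff)
  then show ?thesis using X
  proof (induction U)
    case (Int U V)
    then obtain Q\<^sub>1 Q\<^sub>2 where Q: "Q\<^sub>1 \<in> dominated_probs M \<P>" "Q\<^sub>2 \<in> dominated_probs M \<P>"
      and *: "\<And>Y. Y \<in> Linf_c M \<P> \<Longrightarrow> to_Linf Q\<^sub>1 X = to_Linf Q\<^sub>1 Y \<Longrightarrow> Y \<in> U"
        "\<And>Y. Y \<in> Linf_c M \<P> \<Longrightarrow> to_Linf Q\<^sub>2 X = to_Linf Q\<^sub>2 Y \<Longrightarrow> Y \<in> V"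
      by blast
    \<comment> \<open>The fibre of \<open>X\<close> for a common dominating \<open>Q\<close> lies
      inside the fibres for both given measures, hence inside both open sets.\<close>
    obtain Q where "Q \<in> dominated_probs M \<P>" "absolutely_continuous Q Q\<^sub>1"
      "absolutely_continuous Q Q\<^sub>2"
      using dominated_probs_common[OF Q P] .
    then show ?case
      using * Q \<open>X \<in> Linf_c M \<P>\<close> to_Linf_eq_absolutely_continuous[OF P] by blast
  next
    case (UN K)
    then show ?case by blast
  next
    case (Basis S)
    then obtain \<mu> V where \<mu>: "\<mu> \<in> ca_c M \<P>"
      and S: "S = {X \<in> Linf_c M \<P>. class_integral M \<mu> X \<in> V}"
      by blast
    obtain Q where Q: "Q \<in> dominated_probs M \<P>"
      and ac: "absolutely_continuous Q (upper_variation M \<mu>)"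
        "absolutely_continuous Q (upper_variation M (\<lambda>A. - \<mu> A))"
      using obtain_prob_signed_measure[OF P \<mu>] .
    have "Y \<in> S" if "Y \<in> Linf_c M \<P>" "to_Linf Q X = to_Linf Q Y" for Y
      using class_integral_cong[OF P Q ac _ that] Basis.prems that(1) unfolding S by simp
    then show ?case using Q by blast
  qed simp
qed

text \<open>All generators lie in \<open>Linf_c M \<P>\<close>, and \<mu> = 0 with V =
  \<open>UNIV\<close> gives the whole of it.\<close>

lemma topspace_weak_topology: "topspace (weak_topology M \<P>) = Linf_c M \<P>"
proof -
  have "(\<lambda>_. 0) \<in> ca_c M \<P>" by (simp add: ca_c_def ca_def)
  then show ?thesis
    unfolding weak_topology_def topology_generated_by_topspace by blast
qed

theorem proposition3p8:
  fixes M :: "'a measure" and \<P> :: "'a measure set" and \<A> :: "('a \<Rightarrow> real) set set"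
  assumes "\<P> \<noteq> {}" and "\<P> \<subseteq> prob_measures M"
    and "\<A> \<subseteq> Linf_c M \<P>"
    and "Linf_convex M \<P> \<A>"
    and "closedin (weak_topology M \<P>) \<A>"
  shows "sensitive M \<P> \<A>"
proof -
  have "X \<in> \<A>" if X: "X \<in> Linf_c M \<P>"
    and all: "\<forall>Q\<in>dominated_probs M \<P>. to_Linf Q X \<in> to_Linf Q ` \<A>" for X
  proof (rule ccontr)
    assume "X \<notin> \<A>"
    with X have "X \<in> Linf_c M \<P> - \<A>" by simp
    moreover have "openin (weak_topology M \<P>) (Linf_c M \<P> - \<A>)"
      using assms(5) by (simp add: closedin_def topspace_weak_topology)
    ultimately obtain Q where Q: "Q \<in> dominated_probs M \<P>"
      and *: "\<And>Y. Y \<in> Linf_c M \<P> \<Longrightarrow> to_Linf Q X = to_Linf Q Y \<Longrightarrow> Y \<in> Linf_c M \<P> - \<A>"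
      using weak_open_contains_fibre[OF assms(1,2) _ _ X] by meson
    \<comment> \<open>The assumption on \<open>X\<close>, applied to this particular
      \<open>Q\<close>, puts a point of \<A> into the fibre of \<open>X\<close>, although that fibre
      avoids \<A>.\<close>
    obtain Y where "Y \<in> \<A>" "to_Linf Q X = to_Linf Q Y" using all Q by auto
    then show False using * assms(3) by blast
  qed
  then have "\<A> = {X \<in> Linf_c M \<P>. \<forall>Q\<in>dominated_probs M \<P>. to_Linf Q X \<in> to_Linf Q ` \<A>}"
    using assms(3) by auto
  moreover have "dominated_probs M \<P> \<subseteq> prob_measures M"
    "dominated M (dominated_probs M \<P>) \<P>"
    by (auto simp: dominated_probs_def dominated_def)
  ultimately show ?thesis unfolding sensitive_def by blast
qed

end
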